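(* Let $G$ and $H$ be connected graphs, and let $G'$ and $H'$ be connected subgraphs of $G$ and $H$, respectively, such that none of the four graphs $G, H, G', H'$ has a pendent edge. If at least one of $G'$ and $H'$ is non-bipartite, then $md(G * H) \le md(G' * H')$.
   Context: The tensor product $G * H$ has vertex set $V(G)\times V(H)$, with $(u,v)$ and $(u',v')$ adjacent if and only if $uu' \in E(G)$ and $vv' \in E(H)$. A pendent edge is an edge with an endpoint of degree 1. An edge-coloring of a graph $G$ is a map $\Gamma: E(G) \to [k]$ (adjacent edges may receive the same color). An edge-cut is monochromatic if all of its edges have the same color. An edge-coloring of $G$ is a monochromatic disconnection coloring (MD-coloring) if any two distinct vertices $u,v$ of $G$ are separated by a monochromatic edge-cut (equivalently, for some color $i$, $u$ and $v$ lie in different components of the graph obtained by deleting all edges of color $i$). For a connected graph $G$, $md(G)$ is the maximum number of colors in an MD-coloring of $G$. *)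

theory Defs
  imports "Graph_Theory.Digraph_Component"
begin

text \<open>
  A finite simple undirected graph is a \<^locale>\<open>pair_graph\<close>: every undirected edge is represented
  by its two opposite arcs. Colours and cuts belong to undirected edges, so they are expressed
  through the two-element sets in \<open>edges G\<close>. The library's \<open>connected\<close> includes non-emptiness.
\<close>

definition edges :: "'a pair_pre_digraph \<Rightarrow> 'a set set" where
  "edges G = {{u, v} | u v. (u, v) \<in> parcs G}"

text \<open>In a \<^locale>\<open>pair_graph\<close> the degree of a vertex is its out-degree.\<close>

definition pendent_edge :: "'a pair_pre_digraph \<Rightarrow> 'a set \<Rightarrow> bool" where
  "pendent_edge G e \<longleftrightarrow> e \<in> edges G \<and> (\<exists>v\<in>e. out_degree G v = 1)"

definition bipartite :: "'a pair_pre_digraph \<Rightarrow> bool" where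
  "bipartite G \<longleftrightarrow> (\<exists>X Y. pverts G = X \<union> Y \<and> X \<inter> Y = {} \<and> parcs G \<subseteq> X \<times> Y \<union> Y \<times> X)"

definition tensor_product ::
  "'a pair_pre_digraph \<Rightarrow> 'b pair_pre_digraph \<Rightarrow> ('a \<times> 'b) pair_pre_digraph" where
  "tensor_product G H = \<lparr>
     pverts = pverts G \<times> pverts H,
     parcs = {((u, v), (u', v')) | u v u' v'. (u, u') \<in> parcs G \<and> (v, v') \<in> parcs H}\<rparr>"

definition delete_edges :: "'a pair_pre_digraph \<Rightarrow> 'a set set \<Rightarrow> 'a pair_pre_digraph" where
  "delete_edges G F = \<lparr>
     pverts = pverts G,
     parcs = {(u, v) | u v. (u, v) \<in> parcs G \<and> {u, v} \<notin> F}\<rparr>"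

definition edge_cut :: "'a pair_pre_digraph \<Rightarrow> 'a set set \<Rightarrow> bool" where
  "edge_cut G F \<longleftrightarrow> F \<subseteq> edges G \<and> \<not> connected (delete_edges G F)"

definition separates :: "'a pair_pre_digraph \<Rightarrow> 'a set set \<Rightarrow> 'a \<Rightarrow> 'a \<Rightarrow> bool" where
  "separates G F u v \<longleftrightarrow> \<not> reachable (delete_edges G F) u v"

definition edge_coloring :: "'a pair_pre_digraph \<Rightarrow> nat \<Rightarrow> ('a set \<Rightarrow> nat) \<Rightarrow> bool" where
  "edge_coloring G k \<Gamma> \<longleftrightarrow> (\<forall>e\<in>edges G. \<Gamma> e \<in> {1..k})"

definition monochromatic :: "('a set \<Rightarrow> nat) \<Rightarrow> 'a set set \<Rightarrow> bool" where
  "monochromatic \<Gamma> F \<longleftrightarrow> (\<exists>i. \<forall>e\<in>F. \<Gamma> e = i)"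

definition md_coloring :: "'a pair_pre_digraph \<Rightarrow> nat \<Rightarrow> ('a set \<Rightarrow> nat) \<Rightarrow> bool" where
  "md_coloring G k \<Gamma> \<longleftrightarrow> edge_coloring G k \<Gamma> \<and>
     (\<forall>u\<in>pverts G. \<forall>v\<in>pverts G. u \<noteq> v \<longrightarrow>
        (\<exists>F. edge_cut G F \<and> monochromatic \<Gamma> F \<and> separates G F u v))"

text \<open>
  Since \<open>\<Gamma>\<close> need not be onto \<open>{1..k}\<close>, the number of colours of a colouring is the number of
  colours actually used. The set below is finite, being bounded by the number of edges, and for
  a connected graph it is non-empty, because the constant colouring is an MD-colouring.
\<close>

definition md :: "'a pair_pre_digraph \<Rightarrow> nat" where
  "md G = Max {card (\<Gamma> ` edges G) | \<Gamma> k. md_coloring G k \<Gamma>}"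

end

theory Submission
  imports Defs
begin

text \<open>
  In an MD-coloring opposite edges of every 4-cycle have the same color. If \<open>x\<close> has neighbours
  \<open>y \<noteq> y'\<close> in \<open>G\<close> and \<open>w\<close> has neighbours \<open>v \<noteq> v'\<close> in \<open>H\<close>, then \<open>(x,v)(y,w)\<close> and \<open>(x,v')(y',w)\<close>
  are opposite edges of a 4-cycle of \<open>G * H\<close>. As there are no vertices of degree 1, such moves
  are possible at either end, so every edge of \<open>G * H\<close> can be moved, keeping its color, first
  into \<open>G' * H\<close> along a path in \<open>G\<close> and then into \<open>G' * H'\<close> along a path in \<open>H\<close>. Hence an
  MD-coloring of \<open>G * H\<close> restricts to an MD-coloring of \<open>G' * H'\<close> with the same set of colors.
\<close>

section \<open>Tensor products and edge deletion\<close>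

lemma pverts_tensor_product [simp]:
  "pverts (tensor_product G H) = pverts G \<times> pverts H"
  by (simp add: tensor_product_def)

lemma parcs_tensor_product [simp]:
  "((u, v), (u', v')) \<in> parcs (tensor_product G H) \<longleftrightarrow> (u, u') \<in> parcs G \<and> (v, v') \<in> parcs H"
  by (simp add: tensor_product_def)

lemma pverts_delete_edges [simp]: "pverts (delete_edges G F) = pverts G"
  by (simp add: delete_edges_def)

lemma parcs_delete_edges [simp]:
  "(u, v) \<in> parcs (delete_edges G F) \<longleftrightarrow> (u, v) \<in> parcs G \<and> {u, v} \<notin> F"
  by (simp add: delete_edges_def)

lemma pair_graph_tensor_product:
  assumes "pair_graph G" "pair_graph H"
  shows "pair_graph (tensor_product G H)"
proof -
  interpret G: pair_graph G by fact
  interpret H: pair_graph H by fact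
  have fin: "finite (parcs (tensor_product G H))"
  proof (rule finite_subset)
    show "parcs (tensor_product G H) \<subseteq>
      (\<lambda>((u, u'), (v, v')). ((u, v), (u', v'))) ` (parcs G \<times> parcs H)"
      by (force simp: tensor_product_def)
  qed simp
  show ?thesis
  proof
    show "finite (pverts (tensor_product G H))" by simp
    show "finite (parcs (tensor_product G H))" by (fact fin)
    show "symmetric (tensor_product G H)"
      by (auto simp: symmetric_def sym_def G.arcs_symmetric H.arcs_symmetric)
  qed (auto dest: G.in_arcsD1 G.in_arcsD2 H.in_arcsD1 H.in_arcsD2 G.no_loops')
qed

lemma edgesI: "(u, v) \<in> parcs G \<Longrightarrow> {u, v} \<in> edges G"
  by (auto simp: edges_def)

lemma edges_mono: "parcs G' \<subseteq> parcs G \<Longrightarrow> edges G' \<subseteq> edges G"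
  by (auto simp: edges_def)

lemma finite_edges:
  assumes "finite (parcs G)"
  shows "finite (edges G)"
proof -
  have "edges G = (\<lambda>(u, v). {u, v}) ` parcs G"
    by (auto simp: edges_def)
  with assms show ?thesis by simp
qed

section \<open>Separating cuts and restriction of MD-colorings\<close>

lemma separates_iff:
  "separates G F u v \<longleftrightarrow> (u, v) \<notin> rtrancl_on (pverts G) (parcs (delete_edges G F))"
  by (simp add: separates_def reachable_def)

text \<open>A walk in \<open>G'\<close> that avoids \<open>F \<inter> edges G'\<close> is a walk in
  \<open>G\<close> that avoids \<open>F\<close>. The intersection makes the cut a set of edges of
  \<open>G'\<close>, as \<open>edge_cut\<close> demands.\<close>

lemma separates_subgraph:
  assumes "separates G F u v" "pverts G' \<subseteq> pverts G" "parcs G' \<subseteq> parcs G"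
  shows "separates G' (F \<inter> edges G') u v"
proof -
  have "rtrancl_on (pverts G') (parcs (delete_edges G' (F \<inter> edges G')))
    \<subseteq> rtrancl_on (pverts G) (parcs (delete_edges G F))"
    using assms(2,3) by (auto elim!: rtrancl_on_mono[rotated -1] dest: edgesI)
  with assms(1) show ?thesis
    unfolding separates_iff by auto
qed

text \<open>\<open>connected\<close> refers to the symmetric closure. Deleting an edge removes both
  of its arcs, so the remaining graph is already symmetric and an unreachable pair disconnects
  it.\<close>

lemma separates_imp_edge_cut:
  assumes "pair_graph G" "separates G F u v" "u \<in> pverts G" "v \<in> pverts G" "F \<subseteq> edges G"
  shows "edge_cut G F"
proof -
  interpret pair_graph G by fact
  have "parcs (mk_symmetric (delete_edges G F)) = parcs (delete_edges G F)"
    by (auto simp: parcs_mk_symmetric arcs_symmetric insert_commute)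
  with assms show ?thesis
    by (auto simp: edge_cut_def connected_def strongly_connected_def separates_iff reachable_def)
qed

lemma md_coloring_subgraph:
  assumes "md_coloring G k \<Gamma>" "pair_graph G'" "pverts G' \<subseteq> pverts G" "parcs G' \<subseteq> parcs G"
  shows "md_coloring G' k \<Gamma>"
  unfolding md_coloring_def
proof (intro conjI ballI impI)
  show "edge_coloring G' k \<Gamma>"
    using assms(1) edges_mono[OF assms(4)] by (auto simp: md_coloring_def edge_coloring_def)
next
  fix u v assume uv: "u \<in> pverts G'" "v \<in> pverts G'" "u \<noteq> v"
  with assms(1,3) obtain F where F: "monochromatic \<Gamma> F" "separates G F u v"
    by (metis md_coloring_def subsetD)
  have sep: "separates G' (F \<inter> edges G') u v"
    by (rule separates_subgraph[OF F(2) assms(3,4)])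
  then have "edge_cut G' (F \<inter> edges G')"
    using assms(2) uv by (auto intro: separates_imp_edge_cut)
  moreover have "monochromatic \<Gamma> (F \<inter> edges G')"
    using F(1) by (auto simp: monochromatic_def)
  ultimately show "\<exists>F. edge_cut G' F \<and> monochromatic \<Gamma> F \<and> separates G' F u v"
    using sep by blast
qed

text \<open>Deleting all edges isolates every vertex. This keeps the set under \<open>Max\<close> in
  \<open>md\<close> non-empty.\<close>

lemma md_coloring_const:
  assumes "pair_graph G"
  shows "md_coloring G 1 (\<lambda>_. 1)"
  unfolding md_coloring_def
proof (intro conjI ballI impI)
  show "edge_coloring G 1 (\<lambda>_. 1)"
    by (simp add: edge_coloring_def)
next
  fix u v assume uv: "u \<in> pverts G" "v \<in> pverts G" "u \<noteq> v"
  have "parcs (delete_edges G (edges G)) = {}"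
    by (auto simp: edges_def)
  with uv have "separates G (edges G) u v"
    by (auto simp: separates_iff elim: rtrancl_on.cases)
  with assms uv show "\<exists>F. edge_cut G F \<and> monochromatic (\<lambda>_. 1) F \<and> separates G F u v"
    by (intro exI[of _ "edges G"]) (auto simp: monochromatic_def intro: separates_imp_edge_cut)
qed

section \<open>Opposite edges of a 4-cycle\<close>

lemma md_coloring_4cycle:
  assumes "pair_graph G" "md_coloring G k \<Gamma>"
    and arcs: "(a, b) \<in> parcs G" "(b, c) \<in> parcs G" "(c, d) \<in> parcs G" "(d, a) \<in> parcs G"
    and "a \<noteq> c" "b \<noteq> d"
  shows "\<Gamma> {a, b} = \<Gamma> {c, d}"
proof -
  interpret pair_graph G by fact
  \<comment> \<open>A monochromatic cut between \<open>u\<close> and \<open>v\<close> meets both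
    paths of length 2, hence in the same color.\<close>
  have path: "\<exists>i. (\<Gamma> {u, x} = i \<or> \<Gamma> {x, v} = i) \<and> (\<Gamma> {u, y} = i \<or> \<Gamma> {y, v} = i)"
    if "(u, x) \<in> parcs G" "(x, v) \<in> parcs G" "(u, y) \<in> parcs G" "(y, v) \<in> parcs G" "u \<noteq> v"
    for u x y v
  proof -
    have V: "u \<in> pverts G" "v \<in> pverts G" "u \<noteq> v"
      using that by (auto dest: in_arcsD1 in_arcsD2)
    obtain F i where F: "\<forall>e\<in>F. \<Gamma> e = i" "separates G F u v"
      using assms(2) V unfolding md_coloring_def monochromatic_def by metis
    have "{u, z} \<in> F \<or> {z, v} \<in> F" if "(u, z) \<in> parcs G" "(z, v) \<in> parcs G" for z
    proof (rule ccontr)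
      assume "\<not> ({u, z} \<in> F \<or> {z, v} \<in> F)"
      then have "(u, v) \<in> rtrancl_on (pverts G) (parcs (delete_edges G F))"
        using that V by (meson in_arcsD2 parcs_delete_edges rtrancl_on.intros)
      with F(2) show False by (simp add: separates_iff)
    qed
    with F(1) that show ?thesis by blast
  qed
  \<comment> \<open>A cut between adjacent \<open>u\<close> and \<open>v\<close> contains the edge
    itself and meets the path through \<open>x\<close> and \<open>y\<close>, so the color of the
    edge recurs on that path.\<close>
  have adj: "\<Gamma> {u, v} \<in> {\<Gamma> {u, x}, \<Gamma> {x, y}, \<Gamma> {y, v}}"
    if "(u, v) \<in> parcs G" "(u, x) \<in> parcs G" "(x, y) \<in> parcs G" "(y, v) \<in> parcs G"
    for u x y v
  proof -
    have V: "u \<in> pverts G" "v \<in> pverts G" "x \<in> pverts G" "y \<in> pverts G" "u \<noteq> v"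
      using that no_loops' by (auto dest: in_arcsD1 in_arcsD2)
    obtain F i where F: "\<forall>e\<in>F. \<Gamma> e = i" "separates G F u v"
      using assms(2) V unfolding md_coloring_def monochromatic_def by metis
    have "{u, v} \<in> F"
    proof (rule ccontr)
      assume "{u, v} \<notin> F"
      then have "(u, v) \<in> rtrancl_on (pverts G) (parcs (delete_edges G F))"
        using that V by (meson parcs_delete_edges rtrancl_on.intros)
      with F(2) show False by (simp add: separates_iff)
    qed
    moreover have "{u, x} \<in> F \<or> {x, y} \<in> F \<or> {y, v} \<in> F"
    proof (rule ccontr)
      assume nF: "\<not> ({u, x} \<in> F \<or> {x, y} \<in> F \<or> {y, v} \<in> F)"
      let ?R = "rtrancl_on (pverts G) (parcs (delete_edges G F))"
      have "(u, x) \<in> ?R"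
        using nF that V by (meson parcs_delete_edges rtrancl_on.intros)
      then have "(u, y) \<in> ?R"
        by (rule rtrancl_on_into_rtrancl_on) (use nF that V in auto)
      then have "(u, v) \<in> ?R"
        by (rule rtrancl_on_into_rtrancl_on) (use nF that V in auto)
      with F(2) show False by (simp add: separates_iff)
    qed
    ultimately show ?thesis using F(1) by auto
  qed
  note arcs' = arcs[THEN arcs_symmetric]
  have comm: "{b, a} = {a, b}" "{c, b} = {b, c}" "{d, c} = {c, d}" "{a, d} = {d, a}"
    by auto
  have "\<exists>i. (\<Gamma> {a, b} = i \<or> \<Gamma> {b, c} = i) \<and> (\<Gamma> {d, a} = i \<or> \<Gamma> {c, d} = i)"
    using path[of a b c d] arcs arcs' assms(7) unfolding comm by blast
  moreover have "\<exists>i. (\<Gamma> {a, b} = i \<or> \<Gamma> {d, a} = i) \<and> (\<Gamma> {b, c} = i \<or> \<Gamma> {c, d} = i)"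
    using path[of b a d c] arcs arcs' assms(8) unfolding comm by blast
  moreover have "\<Gamma> {a, b} = \<Gamma> {d, a} \<or> \<Gamma> {a, b} = \<Gamma> {c, d} \<or> \<Gamma> {a, b} = \<Gamma> {b, c}"
    using adj[of a b d c] arcs arcs' unfolding comm by simp
  moreover have "\<Gamma> {c, d} = \<Gamma> {b, c} \<or> \<Gamma> {a, b} = \<Gamma> {c, d} \<or> \<Gamma> {c, d} = \<Gamma> {d, a}"
    using adj[of c d b a] arcs arcs' unfolding comm by auto
  \<comment> \<open>If \<open>{b, c}\<close> and \<open>{d, a}\<close> have the same color, the two
    facts from \<open>adj\<close> give \<open>{a, b}\<close> and \<open>{c, d}\<close> that color or
    each other's. Otherwise the two facts from \<open>path\<close> already force the
    equality.\<close>
  ultimately show ?thesis by metis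
qed

section \<open>Moving edges into a subgraph\<close>

lemma (in pair_graph) another_neighbour:
  assumes "\<nexists>e. pendent_edge G e" "(x, y) \<in> parcs G"
  obtains z where "(x, z) \<in> parcs G" "z \<noteq> y"
proof (rule ccontr)
  assume "\<not> thesis"
  with assms(2) that have "{z. (x, z) \<in> parcs G} = {y}"
    by blast
  moreover have "out_arcs G x = Pair x ` {z. (x, z) \<in> parcs G}"
    by (auto simp: out_arcs_def)
  ultimately have "out_degree G x = 1"
    by (simp add: out_degree_def)
  with assms(2) have "pendent_edge G {x, y}"
    by (auto simp: pendent_edge_def intro: edgesI)
  with assms(1) show False by blast
qed

text \<open>A walk between distinct vertices uses an arc. In the subgraph this arc is the target of
  the moves.\<close>

lemma connected_imp_arc:
  assumes "connected (with_proj G)" "card (pverts G) \<ge> 2"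
  obtains x y where "(x, y) \<in> parcs G"
proof -
  obtain u v where uv: "u \<in> pverts G" "v \<in> pverts G" "u \<noteq> v"
    using assms(2) by (metis card_le_Suc0_iff_eq card.infinite not_less_eq_eq
        numeral_2_eq_2 zero_le)
  with assms(1) have "(u, v) \<in> rtrancl_on (pverts G) (parcs (mk_symmetric G))"
    by (auto simp: connected_def strongly_connected_def reachable_def)
  with uv(3) have "parcs (mk_symmetric G) \<noteq> {}"
    by (auto elim: rtrancl_on.cases)
  with that show ?thesis by (auto simp: parcs_mk_symmetric)
qed

text \<open>
  The value \<open>f x y v w\<close> stands for the color of the edge \<open>(x,v)(y,w)\<close>. Only the \<open>G\<close>-part
  of an edge is steered, so the lemma can be applied once to each factor.
\<close>

lemma move_into_subgraph:
  assumes G: "pair_graph G" "connected (with_proj G)"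
    and G': "pair_graph G'" "pverts G' \<subseteq> pverts G" "parcs G' \<subseteq> parcs G" "parcs G' \<noteq> {}"
      "\<nexists>e. pendent_edge G' e"
    and H: "pair_graph H" "\<nexists>e. pendent_edge H e"
    and sym: "\<And>x y v w. f x y v w = f y x w v"
    and flip: "\<And>x y y' v v' w. \<lbrakk>(x, y) \<in> parcs G; (x, y') \<in> parcs G; y \<noteq> y';
      (v, w) \<in> parcs H; (v', w) \<in> parcs H; v \<noteq> v'\<rbrakk> \<Longrightarrow> f x y v w = f x y' v' w"
    and arcs: "(x, y) \<in> parcs G" "(v, w) \<in> parcs H"
  shows "\<exists>(x', y')\<in>parcs G'. \<exists>(v', w')\<in>parcs H. f x y v w = f x' y' v' w'"
proof -
  interpret G: pair_graph G by fact
  interpret G': pair_graph G' by fact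
  interpret H: pair_graph H by fact
  obtain x0 y0 where x0: "(x0, y0) \<in> parcs G'" using G'(4) by auto
  have other: "\<exists>v'. (v', w) \<in> parcs H \<and> v \<noteq> v'" if "(v, w) \<in> parcs H" for v w
    using H.another_neighbour[OF H(2) H.arcs_symmetric[OF that]] H.arcs_symmetric by metis
  have "strongly_connected (with_proj G)"
    using G.symmetric_connected_imp_strongly_connected[OF G.sym_arcs G(2)] .
  moreover have "x0 \<in> pverts G" "x \<in> pverts G"
    using x0 arcs G' by (auto dest: G.in_arcsD1)
  ultimately have "x0 \<rightarrow>\<^sup>*\<^bsub>G\<^esub> x"
    by (auto simp: strongly_connected_def)
  then show ?thesis
    using arcs
  \<comment> \<open>The walk starts at \<open>x0\<close> in \<open>G'\<close>, and the induction
    brings the end \<open>x\<close> of the edge back to it. The other coordinates change with every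
    move.\<close>
  proof (induction arbitrary: y v w rule: G.reachable_induct)
    case base
    \<comment> \<open>One flip around \<open>x0\<close> puts the \<open>G\<close>-part into
      \<open>G'\<close>. The flip needs \<open>z\<close> distinct from \<open>y\<close>, so a second
      neighbour in \<open>G'\<close> is taken if \<open>y0\<close> equals \<open>y\<close>.\<close>
    obtain z where z: "(x0, z) \<in> parcs G'" "z \<noteq> y"
    proof (cases "y0 = y")
      case True
      with G'.another_neighbour[OF G'(5) x0] that show ?thesis by metis
    qed (use x0 that in blast)
    obtain v' where v': "(v', w) \<in> parcs H" "v \<noteq> v'" using other base by metis
    have "f x0 y v w = f x0 z v' w"
      using flip[of x0 y z v w v'] z v' base G'(3) by auto
    with z v' show ?case by blast
  next
    case (step x z)
    have xz: "(x, z) \<in> parcs G" using step by simp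
    show ?case
    proof (cases "y = x")
      case True
      then have "f z y v w = f x z w v" using sym by simp
      with step.IH[OF xz H.arcs_symmetric[OF step.prems(2)]] show ?thesis by simp
    next
      case False
      \<comment> \<open>A flip around \<open>z\<close> turns the \<open>G\<close>-part into the walk
        edge from \<open>z\<close> to \<open>x\<close>. Reversing it by \<open>sym\<close> gives an
        edge starting at \<open>x\<close>, ready for the induction hypothesis.\<close>
      obtain v' where v': "(v', w) \<in> parcs H" "v \<noteq> v'" using other step.prems by metis
      have "f z y v w = f z x v' w"
        using flip[of z y x v w v'] v' step.prems False G.arcs_symmetric[OF xz] by auto
      also have "\<dots> = f x z w v'" by (rule sym)
      finally show ?thesis
        using step.IH[OF xz H.arcs_symmetric[OF v'(1)]] by simp
    qed
  qed
qed

section \<open>Comparison of the two products\<close>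

theorem theorem4p9:
  fixes G G' :: "'a pair_pre_digraph" and H H' :: "'b pair_pre_digraph"
  assumes "pair_graph G" "pair_graph H" "pair_graph G'" "pair_graph H'"
    and "connected G" "connected H" "connected G'" "connected H'"
    and "subgraph G' G" "subgraph H' H"
    and "card (pverts G') \<ge> 2" "card (pverts H') \<ge> 2"
    and "\<nexists>e. pendent_edge G e" "\<nexists>e. pendent_edge H e"
    and "\<nexists>e. pendent_edge G' e" "\<nexists>e. pendent_edge H' e"
    and "\<not> bipartite G' \<or> \<not> bipartite H'"
  shows "md (tensor_product G H) \<le> md (tensor_product G' H')"
proof -
  let ?T = "tensor_product G H" and ?T' = "tensor_product G' H'"
  have T: "pair_graph ?T" and T': "pair_graph ?T'"
    using assms(1-4) by (simp_all add: pair_graph_tensor_product)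
  interpret G: pair_graph G by fact
  interpret H: pair_graph H by fact
  have G': "pverts G' \<subseteq> pverts G" "parcs G' \<subseteq> parcs G" "parcs G' \<noteq> {}"
    using assms(9) connected_imp_arc[OF assms(7,11)] by (auto simp: subgraph_def)
  have H': "pverts H' \<subseteq> pverts H" "parcs H' \<subseteq> parcs H" "parcs H' \<noteq> {}"
    using assms(10) connected_imp_arc[OF assms(8,12)] by (auto simp: subgraph_def)
  have T'T: "pverts ?T' \<subseteq> pverts ?T" "parcs ?T' \<subseteq> parcs ?T"
    using G' H' by auto
  have colors: "\<Gamma> ` edges ?T \<subseteq> \<Gamma> ` edges ?T'" if "md_coloring ?T k \<Gamma>" for \<Gamma> k
  proof clarify
    fix e assume "e \<in> edges ?T"
    then obtain x v y w where e: "e = {(x, v), (y, w)}" "(x, y) \<in> parcs G" "(v, w) \<in> parcs H"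
      by (auto simp: edges_def)
    have sym: "\<Gamma> {(x, v), (y, w)} = \<Gamma> {(y, w), (x, v)}" for x y v w
      by (simp add: insert_commute)
    \<comment> \<open>The 4-cycle is \<open>(x, v)\<close>, \<open>(y, w)\<close>,
      \<open>(x, v')\<close>, \<open>(y', w)\<close>; \<open>v \<noteq> v'\<close> and
      \<open>y \<noteq> y'\<close> make its opposite vertices distinct.\<close>
    have flip: "\<Gamma> {(x, v), (y, w)} = \<Gamma> {(x, v'), (y', w)}"
      if "(x, y) \<in> parcs G" "(x, y') \<in> parcs G" "y \<noteq> y'"
        "(v, w) \<in> parcs H" "(v', w) \<in> parcs H" "v \<noteq> v'" for x y y' v v' w
      using md_coloring_4cycle[OF T \<open>md_coloring ?T k \<Gamma>\<close>, of "(x, v)" "(y, w)" "(x, v')" "(y', w)"]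
        that by (simp add: G.arcs_symmetric H.arcs_symmetric)
    obtain x1 y1 v1 w1 where 1: "(x1, y1) \<in> parcs G'" "(v1, w1) \<in> parcs H"
      "\<Gamma> e = \<Gamma> {(x1, v1), (y1, w1)}"
      using move_into_subgraph[of G G' H "\<lambda>x y v w. \<Gamma> {(x, v), (y, w)}", OF assms(1,5,3)
          G' assms(15,2,14) sym flip e(2,3)] e(1) by auto
    \<comment> \<open>This is \<open>flip\<close> read from the other end of the edge, with the
      factors exchanged. Taking the \<open>G\<close>-part from \<open>G'\<close> keeps it there
      while the \<open>H\<close>-part moves into \<open>H'\<close>.\<close>
    have flip': "\<Gamma> {(x, v), (y, w)} = \<Gamma> {(x', v), (y, w')}"
      if "(v, w) \<in> parcs H" "(v, w') \<in> parcs H" "w \<noteq> w'"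
        "(x, y) \<in> parcs G'" "(x', y) \<in> parcs G'" "x \<noteq> x'" for x x' y v w w'
      using flip[of y x x' w v w'] sym that G'(2)
      by (metis G.arcs_symmetric H.arcs_symmetric subsetD)
    obtain v2 w2 x2 y2 where "(v2, w2) \<in> parcs H'" "(x2, y2) \<in> parcs G'"
      "\<Gamma> e = \<Gamma> {(x2, v2), (y2, w2)}"
      using move_into_subgraph[of H H' G' "\<lambda>v w x y. \<Gamma> {(x, v), (y, w)}", OF assms(2,6,4)
          H' assms(16,3,15) sym flip' 1(2,1)] 1(3) by auto
    then show "\<Gamma> e \<in> \<Gamma> ` edges ?T'"
      by (auto intro!: imageI edgesI)
  qed
  let ?C = "\<lambda>K :: ('a \<times> 'b) pair_pre_digraph. {card (\<Gamma> ` edges K) | \<Gamma> k. md_coloring K k \<Gamma>}"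
  have fin: "finite (?C K)" if "pair_graph K" for K
  proof (rule finite_subset)
    interpret pair_graph K by fact
    show "?C K \<subseteq> {..card (edges K)}"
      by (auto intro!: card_image_le finite_edges)
  qed simp
  have "Max (?C ?T) \<le> Max (?C ?T')"
  proof (rule Max_mono)
    show "?C ?T \<noteq> {}" using md_coloring_const[OF T] by blast
    show "finite (?C ?T')" using T' by (rule fin)
    show "?C ?T \<subseteq> ?C ?T'"
    proof clarify
      fix \<Gamma> k assume \<Gamma>: "md_coloring ?T k \<Gamma>"
      \<comment> \<open>Equality is what makes the restricted coloring contribute the same number to
        the set for \<open>?T'\<close>.\<close>
      have "\<Gamma> ` edges ?T = \<Gamma> ` edges ?T'"
        using colors[OF \<Gamma>] edges_mono[OF T'T(2)] by blast
      moreover have "md_coloring ?T' k \<Gamma>"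
        using md_coloring_subgraph[OF \<Gamma> T' T'T] .
      ultimately show "\<exists>\<Gamma>' k'. card (\<Gamma> ` edges ?T) = card (\<Gamma>' ` edges ?T') \<and> md_coloring ?T' k' \<Gamma>'"
        by auto
    qed
  qed
  then show ?thesis by (simp add: md_def)
qed

end
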